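(* For every integer $n>1$, the number $11\times(10^{n}-1)$ is a Ball magic number.
   Context: Ball magic number: let $N\ge 2$ and let $x$ be a positive integer with exactly $N$ decimal digits, $x=a_{N-1}\dots a_1a_0$ with $a_{N-1}\neq 0$, which is not a palindrome. Its reverse $x'$ is the integer whose decimal digit string is $a_0a_1\dots a_{N-1}$ (leading zeros allowed). Let $y=|x-x'|$, written as an $N$-digit string $b_{N-1}\dots b_0$ (padding with leading zeros if necessary), and let $y'$ be the integer with digit string $b_0b_1\dots b_{N-1}$. The nonzero integer $B=y+y'$ is called the Ball magic number obtained from $x$; a Ball magic number is any integer obtained this way from some such $x$. *)

theory Defs
  imports Main
begin

text \<open>Digit strings are lists with the most significant digit first, hence the \<open>rev\<close>:
  \<open>horner_sum\<close> expects the least significant digit first. Leading zeros are allowed.\<close>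

definition decimal_value :: "nat list \<Rightarrow> int" where
  "decimal_value ds = horner_sum int 10 (rev ds)"

definition is_digit_string :: "nat \<Rightarrow> nat list \<Rightarrow> bool" where
  "is_digit_string N ds \<longleftrightarrow> length ds = N \<and> (\<forall>d \<in> set ds. d < 10)"

text \<open>\<open>b\<close> is the string of \<open>\<bar>x - x'\<bar>\<close> padded to the same length \<open>N\<close> as the string \<open>a\<close> of \<open>x\<close>;
  being a palindrome is a property of \<open>a\<close>, which has no leading zero.\<close>

definition ball_magic_obtained_from :: "int \<Rightarrow> int \<Rightarrow> bool" where
  "ball_magic_obtained_from x B \<longleftrightarrow>
     (\<exists>N a b. N \<ge> 2 \<and> 0 < x \<and>
        is_digit_string N a \<and> hd a \<noteq> 0 \<and> decimal_value a = x \<and> rev a \<noteq> a \<and>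
        is_digit_string N b \<and> decimal_value b = \<bar>x - decimal_value (rev a)\<bar> \<and>
        B = decimal_value b + decimal_value (rev b))"

definition ball_magic_number :: "int \<Rightarrow> bool" where
  "ball_magic_number B \<longleftrightarrow> (\<exists>x. ball_magic_obtained_from x B)"

end

theory Submission
  imports Defs
begin

text \<open>The number \<open>20\<dots>01\<close> with \<open>n + 1\<close> digits exceeds its reverse \<open>10\<dots>02\<close> by \<open>10 ^ n - 1\<close>.
  Padded to \<open>n + 1\<close> digits this is \<open>09\<dots>9\<close>, whose reverse \<open>9\<dots>90\<close> is ten times as large.\<close>

text \<open>Since \<open>rev\<close> moves the leading digit to the end, evaluating a string and its
  reversal takes rules for both ends: this one and \<open>decimal_value_Cons\<close>.\<close>

lemma decimal_value_snoc [simp]: "decimal_value (ds @ [d]) = 10 * decimal_value ds + int d"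
  by (simp add: decimal_value_def)

lemma decimal_value_Nil [simp]: "decimal_value [] = 0"
  by (simp add: decimal_value_def)

lemma decimal_value_Cons [simp]:
  "decimal_value (d # ds) = int d * 10 ^ length ds + decimal_value ds"
  by (simp add: decimal_value_def horner_sum_append)

lemma decimal_value_replicate_0 [simp]: "decimal_value (replicate n 0) = 0"
  by (induction n) simp_all

lemma decimal_value_replicate_9 [simp]: "decimal_value (replicate n 9) = 10 ^ n - 1"
  by (induction n) simp_all

theorem theorem20:
  fixes n :: nat
  assumes "n > 1"
  shows "ball_magic_number (11 * (10 ^ n - 1))"
proof -
  \<comment> \<open>The two outer digits and \<open>m\<close> inner zeros of \<open>a\<close> make
    \<open>m + 2 = n + 1\<close> digits.\<close>
  obtain m where n: "n = Suc m"
    using assms by (cases n) auto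
  define a :: "nat list" where "a = 2 # replicate m 0 @ [1]"
  define b :: "nat list" where "b = 0 # replicate n 9"
  have a: "decimal_value a = 2 * 10 ^ n + 1"
    by (simp add: a_def n)
  have rev_a: "decimal_value (rev a) = 10 ^ n + 2"
    by (simp add: a_def n)
  have b: "decimal_value b = 10 ^ n - 1"
    by (simp add: b_def)
  have rev_b: "decimal_value (rev b) = 10 * (10 ^ n - 1)"
    by (simp add: b_def)
  have "ball_magic_obtained_from (decimal_value a) (11 * (10 ^ n - 1))"
    unfolding ball_magic_obtained_from_def
  proof (intro exI conjI)
    show "n + 1 \<ge> 2"
      using assms by simp
    show "0 < decimal_value a"
      by (simp add: a add_pos_pos)
    show "is_digit_string (n + 1) a" "hd a \<noteq> 0" "rev a \<noteq> a"
      by (auto simp: is_digit_string_def a_def n)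
    show "is_digit_string (n + 1) b"
      by (auto simp: is_digit_string_def b_def)
    show "decimal_value b = \<bar>decimal_value a - decimal_value (rev a)\<bar>"
      by (simp add: a rev_a b)
    show "11 * (10 ^ n - 1) = decimal_value b + decimal_value (rev b)"
      by (simp add: b rev_b)
  \<comment> \<open>What remains is \<open>decimal_value a = x\<close>, where \<open>x\<close> is
    \<open>decimal_value a\<close> itself.\<close>
  qed (rule refl)
  then show ?thesis
    unfolding ball_magic_number_def by blast
qed

end
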